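(* Let $n\ge 3$ and $T_{4,n}=C_4\Box C_n$. Then $\chi(T_{4,n}^2)=6$ if $n\equiv 0\pmod 3$; $\chi(T_{4,4}^2)=8$; and $\chi(T_{4,n}^2)=7$ otherwise (i.e. if $n\not\equiv 0\pmod 3$ and $n\ne 4$).
   Context: $C_j$ denotes the cycle on $j$ vertices; $\Box$ is the Cartesian product of graphs. The square $G^2$ of a graph $G$ has vertex set $V(G)$, two distinct vertices being adjacent iff their distance in $G$ is at most 2. $\chi$ is the chromatic number. *)

theory Defs
  imports "Graph_Theory.Pair_Digraph" "Graph_Theory.Shortest_Path"
begin

text \<open>
  A finite simple graph is a symmetric loop-free digraph without parallel arcs
  (locale \<^locale>\<open>pair_graph\<close>): an edge is represented by its two arcs.
\<close>

text \<open>The cycle on \<open>n\<close> vertices is only intended for \<open>n \<ge> 3\<close>.\<close>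

definition cycle_graph :: "nat \<Rightarrow> nat pair_pre_digraph" where
  "cycle_graph n = \<lparr> pverts = {..<n},
     parcs = {(i, j). i < n \<and> j < n \<and> (j = (i + 1) mod n \<or> i = (j + 1) mod n)} \<rparr>"

definition cartesian_product ::
  "'a pair_pre_digraph \<Rightarrow> 'b pair_pre_digraph \<Rightarrow> ('a \<times> 'b) pair_pre_digraph"
  (infixr \<open>\<box>\<close> 70) where
  "G \<box> H = \<lparr> pverts = pverts G \<times> pverts H,
     parcs = {((a, b), (a', b')).
       (a = a' \<and> a \<in> pverts G \<and> (b, b') \<in> parcs H) \<or>
       (b = b' \<and> b \<in> pverts H \<and> (a, a') \<in> parcs G)} \<rparr>"

text \<open>
  Every arc has cost 1, so this is the infimum of the numbers of arcs of the walks
  from \<open>u\<close> to \<open>v\<close>, and \<open>\<infinity>\<close> if there is no such walk.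
\<close>

definition graph_distance :: "'a pair_pre_digraph \<Rightarrow> 'a \<Rightarrow> 'a \<Rightarrow> ereal" where
  "graph_distance G u v = wf_digraph.\<mu> (with_proj G) (\<lambda>_. 1) u v"

definition graph_square :: "'a pair_pre_digraph \<Rightarrow> 'a pair_pre_digraph" where
  "graph_square G = \<lparr> pverts = pverts G,
     parcs = {(u, v). u \<in> pverts G \<and> v \<in> pverts G \<and> u \<noteq> v \<and> graph_distance G u v \<le> 2} \<rparr>"

definition proper_coloring :: "'a pair_pre_digraph \<Rightarrow> nat \<Rightarrow> ('a \<Rightarrow> nat) \<Rightarrow> bool" where
  "proper_coloring G k c \<longleftrightarrow>
     c ` pverts G \<subseteq> {..<k} \<and> (\<forall>(u, v) \<in> parcs G. c u \<noteq> c v)"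

definition chromatic_number :: "'a pair_pre_digraph \<Rightarrow> nat" where
  "chromatic_number G = (LEAST k. \<exists>c. proper_coloring G k c)"

definition torus_graph :: "nat \<Rightarrow> nat \<Rightarrow> (nat \<times> nat) pair_pre_digraph" where
  "torus_graph m n = cycle_graph m \<box> cycle_graph n"

lemma pair_graphI:
  assumes "finite (pverts G)"
    and "\<And>u v. (u, v) \<in> parcs G \<Longrightarrow> u \<in> pverts G \<and> v \<in> pverts G \<and> u \<noteq> v \<and> (v, u) \<in> parcs G"
  shows "pair_graph G"
proof unfold_locales
  have "parcs G \<subseteq> pverts G \<times> pverts G" using assms(2) by auto
  then show "finite (parcs G)" using assms(1) by (meson finite_SigmaI finite_subset)
  show "symmetric (with_proj G)"
    using assms(2) by (simp add: symmetric_def sym_def)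
  show "fst e \<in> pverts G" "snd e \<in> pverts G" "fst e \<noteq> snd e" if "e \<in> parcs G" for e
    using assms(2)[of "fst e" "snd e"] that by simp_all
qed (rule assms(1))

lemma pair_graphD:
  assumes "pair_graph G"
  shows "finite (pverts G)"
    and "(u, v) \<in> parcs G \<Longrightarrow> u \<in> pverts G \<and> v \<in> pverts G \<and> u \<noteq> v \<and> (v, u) \<in> parcs G"
proof -
  interpret pair_graph G by fact
  show "finite (pverts G)" by (rule pair_finite_verts)
  show "u \<in> pverts G \<and> v \<in> pverts G \<and> u \<noteq> v \<and> (v, u) \<in> parcs G" if "(u, v) \<in> parcs G"
    using arc_fst_in_verts[OF that] arc_snd_in_verts[OF that] pair_no_loops[OF that]
      arcs_ends_symmetric[OF pair_sym_arcs, of u v] that by simp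
qed

lemma pair_graph_cycle_graph:
  assumes "n \<ge> 3"
  shows "pair_graph (cycle_graph n)"
proof -
  have "(i + 1) mod n \<noteq> i" if "i < n" for i
    using assms that by (cases "i + 1 = n") auto
  then show ?thesis
    by (intro pair_graphI) (force simp: cycle_graph_def)+
qed

lemma pair_graph_cartesian_product:
  assumes "pair_graph G" "pair_graph H"
  shows "pair_graph (G \<box> H)"
proof (rule pair_graphI)
  show "finite (pverts (G \<box> H))"
    using assms by (simp add: cartesian_product_def pair_graphD(1))
  show "u \<in> pverts (G \<box> H) \<and> v \<in> pverts (G \<box> H) \<and> u \<noteq> v \<and> (v, u) \<in> parcs (G \<box> H)"
    if "(u, v) \<in> parcs (G \<box> H)" for u v
    using that
    by (auto simp: cartesian_product_def dest: pair_graphD(2)[OF assms(1)] pair_graphD(2)[OF assms(2)])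
qed

lemma graph_distance_le_iff:
  assumes "pair_graph G"
  shows "graph_distance G u v \<le> ereal (real k) \<longleftrightarrow>
    (\<exists>p. pre_digraph.awalk (with_proj G) u p v \<and> length p \<le> k)"
proof -
  interpret pair_graph G by fact
  have cost: "wf_digraph.awalk_cost (\<lambda>_. 1) p = real (length p)" for p :: "('a \<times> 'a) list"
    by (simp add: awalk_cost_def sum_list_triv)
  have eq: "graph_distance G u v = (INF p\<in>{p. awalk u p v}. ereal (real (length p)))"
    by (simp add: graph_distance_def \<mu>_def cost)
  show ?thesis
  proof
    assume le: "graph_distance G u v \<le> ereal (real k)"
    have "(INF p\<in>{p. awalk u p v}. ereal (real (length p))) < ereal (real (k + 1))"
      using le unfolding eq by (rule le_less_trans) simp
    then obtain p where "awalk u p v" "ereal (real (length p)) < ereal (real (k + 1))"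
      unfolding INF_less_iff by blast
    then show "\<exists>p. awalk u p v \<and> length p \<le> k" by auto
  next
    assume "\<exists>p. awalk u p v \<and> length p \<le> k"
    then show "graph_distance G u v \<le> ereal (real k)"
      unfolding eq by (auto intro: INF_lower2)
  qed
qed

lemma pair_graph_graph_square:
  assumes "pair_graph G"
  shows "pair_graph (graph_square G)"
proof (rule pair_graphI)
  interpret pair_graph G by fact
  show "finite (pverts (graph_square G))"
    by (simp add: graph_square_def)
  have rev: "\<exists>q. awalk v q u \<and> length q = length p" if "awalk u p v" for u p v
    using that
  proof (induction p arbitrary: u)
    case Nil
    then show ?case by (auto simp: awalk_Nil_iff)
  next
    case (Cons e p)
    obtain a b where e: "e = (a, b)" by force
    from Cons.prems have arc: "(a, b) \<in> parcs G" "a = u" and aw: "awalk b p v"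
      by (auto simp: awalk_Cons_iff e)
    from Cons.IH[OF aw] obtain q where q: "awalk v q b" "length q = length p" by blast
    have "awalk b [(b, a)] u"
      using pair_graphD(2)[OF assms arc(1)] arc(2) by (auto simp: awalk_def)
    with q have "awalk v (q @ [(b, a)]) u" by (blast intro: awalk_appendI)
    with q(2) show ?case by (intro exI[of _ "q @ [(b, a)]"]) simp
  qed
  have sym: "graph_distance G v u \<le> 2" if "graph_distance G u v \<le> 2" for u v
  proof -
    from that obtain p where "awalk u p v" "length p \<le> 2"
      using graph_distance_le_iff[OF assms, of u v 2] by auto
    with rev obtain q where "awalk v q u" "length q \<le> 2" by metis
    then show ?thesis
      using graph_distance_le_iff[OF assms, of v u 2] by auto
  qed
  show "u \<in> pverts (graph_square G) \<and> v \<in> pverts (graph_square G) \<and> u \<noteq> v \<and>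
      (v, u) \<in> parcs (graph_square G)" if "(u, v) \<in> parcs (graph_square G)" for u v
    using that sym[of u v] by (simp add: graph_square_def eq_commute)
qed

lemma chromatic_number_attained:
  assumes "pair_graph G"
  shows "\<exists>c. proper_coloring G (chromatic_number G) c"
  unfolding chromatic_number_def
proof (rule LeastI_ex)
  obtain c :: "'a \<Rightarrow> nat" and k where "c ` pverts G = {i. i < k}" "inj_on c (pverts G)"
    using finite_imp_inj_to_nat_seg[OF pair_graphD(1)[OF assms]] by auto
  moreover have "c u \<noteq> c v" if "(u, v) \<in> parcs G" for u v
    using \<open>inj_on c (pverts G)\<close> pair_graphD(2)[OF assms that] by (simp add: inj_on_eq_iff)
  ultimately have "proper_coloring G k c"
    by (simp add: proper_coloring_def lessThan_def case_prod_beta)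
  then show "\<exists>k c. proper_coloring G k c" by blast
qed

end

theory Submission
  imports Defs
begin

text \<open>
  A colour that is not repeated within a column occurs in at most two of three consecutive columns,
  because two occurrences in neighbouring columns lie in opposite rows. Counting the colours of three
  consecutive columns gives \<open>12 \<le> 2k\<close>. If \<open>k = 6\<close>, every colour occurs in exactly two of
  any three consecutive columns, so the colour sets of the columns have period 3; if \<open>3\<close> does not
  divide \<open>n\<close>, all of them agree, which is impossible. For \<open>n = 4\<close> any three of the four columns
  are consecutive, whence \<open>16 \<le> 2k\<close>.

  Conversely, blocks of 3, 5 and 7 columns that close up cyclically and start with the same two
  columns can be concatenated, and every \<open>n \<ge> 3\<close> other than 4 has one of the forms \<open>3a\<close>,
  \<open>5 + 3a\<close>, \<open>7 + 3a\<close>.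
\<close>

section \<open>Adjacency in the square\<close>

text \<open>Distance at most 2 means a walk with at most two arcs, and \<open>u \<noteq> v\<close>
  excludes the empty one. This removes the infimum from all later arguments.\<close>

lemma arc_graph_square_iff:
  assumes "pair_graph G"
  shows "(u, v) \<in> parcs (graph_square G) \<longleftrightarrow>
    u \<noteq> v \<and> ((u, v) \<in> parcs G \<or> (\<exists>w. (u, w) \<in> parcs G \<and> (w, v) \<in> parcs G))"
proof -
  interpret pair_graph G by fact
  have short: "(\<exists>p. awalk u p v \<and> length p \<le> 2) \<longleftrightarrow>
      (u, v) \<in> parcs G \<or> (\<exists>w. (u, w) \<in> parcs G \<and> (w, v) \<in> parcs G)" if "u \<noteq> v"
  proof
    assume "\<exists>p. awalk u p v \<and> length p \<le> 2"
    then obtain p where p: "awalk u p v" "length p \<le> 2" by blast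
    consider "p = []" | e where "p = [e]" | e f where "p = [e, f]"
      using p(2) by (cases p; cases "tl p") (auto simp: numeral_2_eq_2)
    then show "(u, v) \<in> parcs G \<or> (\<exists>w. (u, w) \<in> parcs G \<and> (w, v) \<in> parcs G)"
      using p(1) that by cases (auto simp: awalk_Cons_iff awalk_Nil_iff)
  next
    assume "(u, v) \<in> parcs G \<or> (\<exists>w. (u, w) \<in> parcs G \<and> (w, v) \<in> parcs G)"
    then consider "(u, v) \<in> parcs G" | w where "(u, w) \<in> parcs G" "(w, v) \<in> parcs G" by blast
    then show "\<exists>p. awalk u p v \<and> length p \<le> 2"
    proof cases
      case 1
      then have "awalk u [(u, v)] v"
        using pair_graphD(2)[OF assms] by (auto simp: awalk_Cons_iff awalk_Nil_iff)
      then show ?thesis by (intro exI[of _ "[(u, v)]"]) simp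
    next
      case 2
      then have "awalk u [(u, w), (w, v)] v"
        using pair_graphD(2)[OF assms] by (auto simp: awalk_Cons_iff awalk_Nil_iff)
      then show ?thesis by (intro exI[of _ "[(u, w), (w, v)]"]) simp
    qed
  qed
  show ?thesis
    using short graph_distance_le_iff[OF assms, of u v 2] pair_graphD(2)[OF assms]
    by (auto simp: graph_square_def)
qed

lemma pair_graph_torus_graph: "m \<ge> 3 \<Longrightarrow> n \<ge> 3 \<Longrightarrow> pair_graph (torus_graph m n)"
  unfolding torus_graph_def by (intro pair_graph_cartesian_product pair_graph_cycle_graph)

lemma pverts_graph_square_torus: "pverts (graph_square (torus_graph m n)) = {..<m} \<times> {..<n}"
  by (simp add: graph_square_def torus_graph_def cartesian_product_def cycle_graph_def)

lemma add_one_mod_cancel: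
  fixes n :: nat
  assumes "j < n" "k < n"
  shows "(j + 1) mod n = (k + 1) mod n \<longleftrightarrow> j = k"
  using assms by (cases "j + 1 = n"; cases "k + 1 = n") auto

lemma arc_torus_graph_iff:
  "((i, j), (i', j')) \<in> parcs (torus_graph m n) \<longleftrightarrow> i < m \<and> i' < m \<and> j < n \<and> j' < n \<and>
    (i = i' \<and> (j' = (j + 1) mod n \<or> j = (j' + 1) mod n) \<or>
     j = j' \<and> (i' = (i + 1) mod m \<or> i = (i' + 1) mod m))"
  by (auto simp: torus_graph_def cartesian_product_def cycle_graph_def)

lemma less_4_cases: "i < 4 \<longleftrightarrow> i = 0 \<or> i = 1 \<or> i = 2 \<or> i = (3::nat)"
  by auto

text \<open>Necessary conditions suffice for checking colourings, so overlaps of the cases for small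
  \<open>n\<close> do no harm. In \<open>C_4\<close>, \<open>i' \<noteq> (i + 2) mod 4\<close> says
  that the rows are equal or neighbouring.\<close>

lemma arc_square_torusD:
  assumes "n \<ge> 3" "((i, j), (i', j')) \<in> parcs (graph_square (torus_graph 4 n))"
  shows "i < 4 \<and> i' < 4 \<and> j < n \<and> j' < n \<and>
    (j = j' \<and> i \<noteq> i' \<or>
     (j' = (j + 1) mod n \<or> j = (j' + 1) mod n) \<and> i' \<noteq> (i + 2) mod 4 \<or>
     (j' = (j + 2) mod n \<or> j = (j' + 2) mod n) \<and> i = i')"
proof -
  let ?T = "parcs (torus_graph 4 n)"
  have neq: "(i, j) \<noteq> (i', j')"
    and *: "((i, j), (i', j')) \<in> ?T \<or> (\<exists>w. ((i, j), w) \<in> ?T \<and> (w, (i', j')) \<in> ?T)"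
    using assms arc_graph_square_iff[OF pair_graph_torus_graph, of 4 n] by auto
  from * show ?thesis
  proof
    assume "((i, j), (i', j')) \<in> ?T"
    then show ?thesis using neq by (auto simp: arc_torus_graph_iff less_4_cases)
  next
    assume "\<exists>w. ((i, j), w) \<in> ?T \<and> (w, (i', j')) \<in> ?T"
    then obtain a b where w: "((i, j), (a, b)) \<in> ?T" "((a, b), (i', j')) \<in> ?T" by auto
    have bounds: "i < 4" "i' < 4" "a < 4" "j < n" "j' < n" "b < n"
      using w by (auto simp: arc_torus_graph_iff)
    have step: "((x + 1) mod n + 1) mod n = (x + 2) mod n" for x
      by (simp add: mod_simps)
    consider (row) "i = a" "a = i'" "b = (j + 1) mod n \<or> j = (b + 1) mod n"
          "j' = (b + 1) mod n \<or> b = (j' + 1) mod n"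
      | (col) "j = b" "b = j'"
      | (mixed1) "i = a" "b = j'" "j' = (j + 1) mod n \<or> j = (j' + 1) mod n"
          "i' = (a + 1) mod 4 \<or> a = (i' + 1) mod 4"
      | (mixed2) "a = i'" "j = b" "j' = (j + 1) mod n \<or> j = (j' + 1) mod n"
          "a = (i + 1) mod 4 \<or> i = (a + 1) mod 4"
      using w unfolding arc_torus_graph_iff by blast
    then show ?thesis
    proof cases
      case row
      \<comment> \<open>Two steps along \<open>C_n\<close> add up or cancel; cancelling would give
        back the same vertex.\<close>
      then have "j' = (j + 2) mod n \<or> j = (j' + 2) mod n \<or> j = j'"
        using add_one_mod_cancel[OF bounds(4,5)] step by metis
      then show ?thesis using row neq bounds by auto
    next
      case col
      then show ?thesis using neq bounds by auto
    next
      case mixed1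
      then have "i' \<noteq> (i + 2) mod 4" using bounds by (auto simp: less_4_cases)
      then show ?thesis using mixed1 bounds by blast
    next
      case mixed2
      then have "i' \<noteq> (i + 2) mod 4" using bounds by (auto simp: less_4_cases)
      then show ?thesis using mixed2 bounds by blast
    qed
  qed
qed

lemma add_mod_neq:
  fixes n :: nat
  assumes "0 < d" "d < n"
  shows "(j + d) mod n \<noteq> j mod n"
proof
  assume "(j + d) mod n = j mod n"
  then have "n dvd (j + d) - j" by (metis le_add1 mod_eq_dvd_iff_nat)
  then show False using assms by (auto dest: dvd_imp_le)
qed

text \<open>Column indices are arbitrary naturals reduced modulo \<open>n\<close>, so that three
  consecutive columns are always \<open>j\<close>, \<open>j + 1\<close>, \<open>j + 2\<close>,
  without wrap-around cases.\<close>

lemma arc_square_torusI: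
  assumes "n \<ge> 3" "i < 4" "i' < 4"
  shows "i \<noteq> i' \<Longrightarrow>
      ((i, j mod n), (i', j mod n)) \<in> parcs (graph_square (torus_graph 4 n))"
    and "i' \<noteq> (i + 2) mod 4 \<Longrightarrow>
      ((i, j mod n), (i', (j + 1) mod n)) \<in> parcs (graph_square (torus_graph 4 n))"
    and "((i, j mod n), (i, (j + 2) mod n)) \<in> parcs (graph_square (torus_graph 4 n))"
proof -
  let ?T = "parcs (torus_graph 4 n)"
  note sq = arc_graph_square_iff[OF pair_graph_torus_graph[of 4 n]]
  have n: "x mod n < n" for x using assms by simp
  show "((i, j mod n), (i', j mod n)) \<in> parcs (graph_square (torus_graph 4 n))"
    if ne: "i \<noteq> i'"
  proof -
    consider "i' = (i + 1) mod 4" | "i = (i' + 1) mod 4" | "i' = ((i + 1) mod 4 + 1) mod 4"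
      using assms ne by (auto simp: less_4_cases)
    then show ?thesis
    proof cases
      case 3
      then have "((i, j mod n), ((i + 1) mod 4, j mod n)) \<in> ?T"
          "(((i + 1) mod 4, j mod n), (i', j mod n)) \<in> ?T"
        using assms n by (auto simp: arc_torus_graph_iff)
      then show ?thesis using assms ne by (auto simp: sq)
    qed (use assms ne n in \<open>auto simp: sq arc_torus_graph_iff\<close>)
  qed
  have ne1: "(j + 1) mod n \<noteq> j mod n" and ne2: "(j + 2) mod n \<noteq> j mod n"
    using add_mod_neq[of 1 n j] add_mod_neq[of 2 n j] assms by auto
  have step: "((i, j mod n), (i, (j + 1) mod n)) \<in> ?T" if "i < 4" for i j
    using that n by (auto simp: arc_torus_graph_iff mod_simps)
  show "((i, j mod n), (i', (j + 1) mod n)) \<in> parcs (graph_square (torus_graph 4 n))"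
    if ne: "i' \<noteq> (i + 2) mod 4"
  proof -
    consider "i' = i" | "i' = (i + 1) mod 4 \<or> i = (i' + 1) mod 4"
      using assms ne by (auto simp: less_4_cases)
    then show ?thesis
    proof cases
      case 1
      then show ?thesis using step[OF assms(2)] assms ne1 by (auto simp: sq)
    next
      case 2
      then have "((i, j mod n), (i', j mod n)) \<in> ?T"
        using assms n by (auto simp: arc_torus_graph_iff)
      with step[OF assms(3)] show ?thesis
        using assms ne1 by (auto simp: sq)
    qed
  qed
  show "((i, j mod n), (i, (j + 2) mod n)) \<in> parcs (graph_square (torus_graph 4 n))"
    using step[OF assms(2), of j] step[OF assms(2), of "j + 1"] assms ne2 by (auto simp: sq)
qed

section \<open>Lower bounds\<close>

lemma proper_coloringD:
  assumes "proper_coloring G k c"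
  shows "u \<in> pverts G \<Longrightarrow> c u < k" and "(u, v) \<in> parcs G \<Longrightarrow> c u \<noteq> c v"
  using assms by (auto simp: proper_coloring_def)

lemma card_filter_eq_sum:
  "finite A \<Longrightarrow> card {x \<in> A. P x} = (\<Sum>x\<in>A. if P x then 1 else 0)"
  by (simp flip: sum.inter_filter)

text \<open>Pairs \<open>(d, a)\<close> with \<open>a \<in> S d\<close> are counted by
  \<open>d\<close> and by \<open>a\<close>. Equality leaves no slack for any single colour.\<close>

lemma double_count_le_2:
  fixes S :: "'b \<Rightarrow> nat set"
  assumes "finite D" and S: "\<And>d. d \<in> D \<Longrightarrow> S d \<subseteq> {..<k}" "\<And>d. d \<in> D \<Longrightarrow> card (S d) = m"
    and le2: "\<And>a. card {d \<in> D. a \<in> S d} \<le> 2"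
  shows "card D * m \<le> 2 * k"
    and "card D * m = 2 * k \<Longrightarrow> a < k \<Longrightarrow> card {d \<in> D. a \<in> S d} = 2"
proof -
  have "card D * m = (\<Sum>d\<in>D. card (S d))" using S by simp
  also have "\<dots> = (\<Sum>d\<in>D. \<Sum>a<k. if a \<in> S d then 1 else 0)"
  proof (rule sum.cong)
    fix d assume "d \<in> D"
    then have "S d = {a \<in> {..<k}. a \<in> S d}" using S(1) by blast
    then show "card (S d) = (\<Sum>a<k. if a \<in> S d then 1 else 0)"
      by (metis card_filter_eq_sum finite_lessThan)
  qed simp
  also have "\<dots> = (\<Sum>a<k. \<Sum>d\<in>D. if a \<in> S d then 1 else 0)" by (rule sum.swap)
  also have "\<dots> = (\<Sum>a<k. card {d \<in> D. a \<in> S d})"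
    using \<open>finite D\<close> by (simp only: card_filter_eq_sum)
  finally have eq: "card D * m = (\<Sum>a<k. card {d \<in> D. a \<in> S d})" .
  have "(\<Sum>a<k. card {d \<in> D. a \<in> S d}) \<le> (\<Sum>a<k. 2)" by (intro sum_mono le2)
  then show "card D * m \<le> 2 * k" using eq by simp
  assume "card D * m = 2 * k" "a < k"
  then have *: "(\<Sum>a<k. card {d \<in> D. a \<in> S d}) = (\<Sum>a<k. 2)" using eq by simp
  show "card {d \<in> D. a \<in> S d} = 2"
  proof (rule ccontr)
    assume "card {d \<in> D. a \<in> S d} \<noteq> 2"
    then have "card {d \<in> D. a \<in> S d} < 2" using le2[of a] by simp
    then have "(\<Sum>a<k. card {d \<in> D. a \<in> S d}) < (\<Sum>a<k. 2)"
      using \<open>a < k\<close> by (intro sum_strict_mono_ex1) (auto intro: le2)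
    with * show False by simp
  qed
qed

section \<open>Colour sets of consecutive columns\<close>

locale torus_coloring =
  fixes n k :: nat and c :: "nat \<times> nat \<Rightarrow> nat"
  assumes n: "n \<ge> 3" and coloring: "proper_coloring (graph_square (torus_graph 4 n)) k c"
begin

definition column_colors :: "nat \<Rightarrow> nat set" where
  "column_colors j = (\<lambda>i. c (i, j mod n)) ` {..<4}"

lemma column_colors_mod: "j mod n = j' mod n \<Longrightarrow> column_colors j = column_colors j'"
  by (simp add: column_colors_def)

lemma column_colors_subset: "column_colors j \<subseteq> {..<k}"
  using proper_coloringD(1)[OF coloring] n
  by (auto simp: column_colors_def pverts_graph_square_torus)

lemma card_column_colors: "card (column_colors j) = 4"
proof -
  have "inj_on (\<lambda>i. c (i, j mod n)) {..<4}"
    using proper_coloringD(2)[OF coloring] arc_square_torusI(1)[OF n]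
    by (intro inj_onI) (metis lessThan_iff)
  then show ?thesis by (simp add: column_colors_def card_image)
qed

text \<open>A colour kept from one column to the next moves to the opposite row. After two such
  moves it is back in its first row, where the vertices two columns apart are adjacent in the
  square.\<close>

lemma column_colors_Int: "column_colors j \<inter> column_colors (j + 1) \<inter> column_colors (j + 2) = {}"
proof (rule ccontr)
  assume "\<not> ?thesis"
  then obtain a where "a \<in> column_colors j" "a \<in> column_colors (j + 1)" "a \<in> column_colors (j + 2)"
    by blast
  then obtain i i' i'' where i: "i < 4" "i' < 4" "i'' < 4"
    "a = c (i, j mod n)" "a = c (i', (j + 1) mod n)" "a = c (i'', (j + 2) mod n)"
    unfolding column_colors_def by blast
  have step: "j + 1 + 1 = j + 2" by simp
  have "i' = (i + 2) mod 4" "i'' = (i' + 2) mod 4"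
    using arc_square_torusI(2)[OF n] proper_coloringD(2)[OF coloring] i step by metis+
  then have "i'' = i" using i(1) by (auto simp: less_4_cases)
  then show False
    using arc_square_torusI(3)[OF n i(1) i(1)] proper_coloringD(2)[OF coloring] i(4,6) by metis
qed

lemma card_window_le_2: "card {d \<in> {j, j + 1, j + 2}. a \<in> column_colors d} \<le> 2"
proof -
  obtain e where e: "e \<in> {j, j + 1, j + 2}" "a \<notin> column_colors e"
    using column_colors_Int[of j] by blast
  then have "{d \<in> {j, j + 1, j + 2}. a \<in> column_colors d} \<subseteq> {j, j + 1, j + 2} - {e}" by auto
  then have "card {d \<in> {j, j + 1, j + 2}. a \<in> column_colors d} \<le> card ({j, j + 1, j + 2} - {e})"
    by (intro card_mono) auto
  also have "\<dots> = 2" using e(1) by (subst card_Diff_singleton) auto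
  finally show ?thesis .
qed

lemma colors_ge_6: "6 \<le> k"
  using double_count_le_2(1)[of "{0, 0 + 1, 0 + 2}" column_colors k 4]
    column_colors_subset card_column_colors card_window_le_2[of 0] by simp

lemma six_colors_imp_dvd:
  assumes "k = 6"
  shows "n mod 3 = 0"
proof (rule ccontr)
  assume n3: "n mod 3 \<noteq> 0"
  \<comment> \<open>With \<open>k = 6\<close> the count \<open>3 * 4 = 2 * 6\<close> is an equality
    for every window.\<close>
  have two: "card {d \<in> {j, j + 1, j + 2}. a \<in> column_colors d} = 2" if "a < 6" for a j
    using double_count_le_2(2)[of "{j, j + 1, j + 2}" column_colors k 4 a]
      column_colors_subset card_column_colors card_window_le_2[of j] that assms by simp
  have count: "card {d \<in> {j, j + 1, j + 2}. a \<in> column_colors d} =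
      of_bool (a \<in> column_colors j) + of_bool (a \<in> column_colors (j + 1)) +
      of_bool (a \<in> column_colors (j + 2))" for a j
  proof -
    have "card {d \<in> {j, j + 1, j + 2}. a \<in> column_colors d} =
        (\<Sum>d\<in>{j, j + 1, j + 2}. if a \<in> column_colors d then 1 else 0)"
      by (simp only: card_filter_eq_sum finite.intros)
    then show ?thesis by simp
  qed
  \<comment> \<open>The windows at \<open>j\<close> and \<open>j + 1\<close> share two columns and
    have equal totals, so the columns they do not share agree on each colour.\<close>
  have period: "column_colors (j + 3) = column_colors j" for j
  proof -
    have "a \<in> column_colors (j + 3) \<longleftrightarrow> a \<in> column_colors j" if "a < 6" for a
    proof -
      have shift: "j + 1 + 1 = j + 2" "j + 1 + 2 = j + 3" by simp_all
      have "(of_bool (a \<in> column_colors j) :: nat) = of_bool (a \<in> column_colors (j + 3))"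
        using two[OF that, of j] two[OF that, of "j + 1"] unfolding count unfolding shift by linarith
      then show ?thesis by (simp only: of_bool_eq_iff)
    qed
    moreover have "column_colors i \<subseteq> {..<6}" for i
      using column_colors_subset[of i] assms by simp
    ultimately show ?thesis by (meson lessThan_iff subsetD subsetI subset_antisym)
  qed
  have period': "column_colors (j + 3 * q) = column_colors j" for j q
  proof (induction q)
    case (Suc q)
    then show ?case using period[of "j + 3 * q"] by (simp add: algebra_simps)
  qed simp
  have const: "column_colors (j + 1) = column_colors j" for j
  proof -
    \<comment> \<open>The colour sets have periods 3 and \<open>n\<close>. Since 3 does not divide
      \<open>n\<close>, one of \<open>n\<close> and \<open>2 * n\<close> is 1 modulo 3, which yields
      period 1.\<close>
    consider q where "n = 3 * q + 1" | q where "2 * n = 3 * q + 1"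
    proof -
      have "n = 3 * (n div 3) + 1 \<or> 2 * n = 3 * (2 * (n div 3) + 1) + 1" using n3 by presburger
      then show ?thesis using that by blast
    qed
    then show ?thesis
    proof cases
      case (1 q)
      then have "column_colors (j + 1) = column_colors (j + n)"
        using period'[of "j + 1" q] by (simp add: algebra_simps)
      then show ?thesis by (simp add: column_colors_def)
    next
      case (2 q)
      then have "column_colors (j + 1) = column_colors (j + 2 * n)"
        using period'[of "j + 1" q] by (simp add: algebra_simps)
      then show ?thesis by (simp add: column_colors_def)
    qed
  qed
  have "column_colors 0 = {}"
    using column_colors_Int[of 0] const[of 0] const[of 1] by (simp add: numeral_2_eq_2)
  then show False using card_column_colors[of 0] by simp
qed

lemma colors_ge_8:
  assumes "n = 4"
  shows "8 \<le> k"
proof -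
  have "card {d \<in> {..<4}. a \<in> column_colors d} \<le> 2" for a
  proof (rule ccontr)
    assume "\<not> ?thesis"
    then have "card {d \<in> {..<4}. a \<notin> column_colors d} \<le> 1"
      using card_Int_Diff[of "{..<4::nat}" "{d. a \<in> column_colors d}"]
      by (simp add: Int_def set_diff_eq)
    then have one: "x = y" if "x < 4" "y < 4" "a \<notin> column_colors x" "a \<notin> column_colors y" for x y
      using that by (auto simp: card_le_Suc0_iff_eq)
    have wrap: "column_colors 4 = column_colors 0" "column_colors 5 = column_colors 1"
      by (rule column_colors_mod, simp add: assms)+
    \<comment> \<open>Each of the four cyclic windows has a column without \<open>a\<close>, but no
      single column lies in all four windows. So two columns would lack \<open>a\<close>, against
      \<open>one\<close>.\<close>
    have "a \<notin> column_colors 0 \<or> a \<notin> column_colors 1 \<or> a \<notin> column_colors 2"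
      "a \<notin> column_colors 1 \<or> a \<notin> column_colors 2 \<or> a \<notin> column_colors 3"
      "a \<notin> column_colors 2 \<or> a \<notin> column_colors 3 \<or> a \<notin> column_colors 0"
      "a \<notin> column_colors 3 \<or> a \<notin> column_colors 0 \<or> a \<notin> column_colors 1"
      using column_colors_Int[of 0] column_colors_Int[of 1] column_colors_Int[of 2]
        column_colors_Int[of 3] wrap by (auto simp: eval_nat_numeral)
    then show False
      using one[of 0 1] one[of 0 2] one[of 0 3] one[of 1 2] one[of 1 3] one[of 2 3] by auto
  qed
  then show ?thesis
    using double_count_le_2(1)[of "{..<4}" column_colors k 4] column_colors_subset
      card_column_colors by simp
qed

end

section \<open>Colourings from lists of columns\<close>

text \<open>Opposite rows are exempt, being at distance 3 when \<open>n\<close> is at least 3.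
  Listing the indices lets simplification evaluate the check on concrete columns.\<close>

definition near_ok :: "nat list \<Rightarrow> nat list \<Rightarrow> bool" where
  "near_ok x y \<longleftrightarrow> (\<forall>i\<in>{0,1,2,3}. \<forall>i'\<in>{0,1,2,3}. i' \<noteq> (i + 2) mod 4 \<longrightarrow> x ! i \<noteq> y ! i')"

definition far_ok :: "nat list \<Rightarrow> nat list \<Rightarrow> bool" where
  "far_ok x y \<longleftrightarrow> (\<forall>i\<in>{0,1,2,3}. x ! i \<noteq> y ! i)"

text \<open>The last two columns serve as look-ahead only: their length, distinctness and range are
  not tested.\<close>

fun columns_ok :: "nat \<Rightarrow> nat list list \<Rightarrow> bool" where
  "columns_ok k (x # y # z # r) \<longleftrightarrow> length x = 4 \<and> distinct x \<and> set x \<subseteq> {..<k} \<and>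
     near_ok x y \<and> far_ok x z \<and> columns_ok k (y # z # r)"
| "columns_ok k _ \<longleftrightarrow> True"

lemma columns_ok_nth:
  "columns_ok k M \<Longrightarrow> j + 2 < length M \<Longrightarrow> length (M ! j) = 4 \<and> distinct (M ! j) \<and>
     set (M ! j) \<subseteq> {..<k} \<and> near_ok (M ! j) (M ! (j + 1)) \<and> far_ok (M ! j) (M ! (j + 2))"
proof (induction k M arbitrary: j rule: columns_ok.induct)
  case (1 k x y z r)
  then show ?case by (cases j) auto
qed auto

text \<open>Appending the first two columns turns the cyclic conditions into linear ones, and it is in this
  linear form that a block can be put in front of a list.\<close>

lemma proper_coloring_columns:
  assumes "n \<ge> 3" and L: "length L = n" "L = x # y # r" and ok: "columns_ok k (L @ [x, y])"
  shows "proper_coloring (graph_square (torus_graph 4 n)) k (\<lambda>(i, j). L ! j ! i)"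
proof -
  have col: "length (L ! j) = 4" "distinct (L ! j)" "set (L ! j) \<subseteq> {..<k}"
    "near_ok (L ! j) (L ! ((j + 1) mod n))" "far_ok (L ! j) (L ! ((j + 2) mod n))" if "j < n" for j
  proof -
    have wrap: "(L @ [x, y]) ! (j + d) = L ! ((j + d) mod n)" if "d \<le> 2" for d
    proof (cases "j + d < n")
      case True
      then show ?thesis using L(1) by (simp add: nth_append)
    next
      case False
      \<comment> \<open>Only positions \<open>n\<close> and \<open>n + 1\<close> lie beyond
        \<open>L\<close>; they hold the copies of columns 0 and 1.\<close>
      then have "j + d = n \<and> (j + d) mod n = 0 \<or> j + d = n + 1 \<and> (j + d) mod n = 1"
        using \<open>j < n\<close> \<open>n \<ge> 3\<close> that by (auto simp: mod_if)
      then show ?thesis using L by (auto simp: nth_append)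
    qed
    show "length (L ! j) = 4" "distinct (L ! j)" "set (L ! j) \<subseteq> {..<k}"
      "near_ok (L ! j) (L ! ((j + 1) mod n))" "far_ok (L ! j) (L ! ((j + 2) mod n))"
      using columns_ok_nth[OF ok, of j] wrap[of 0] wrap[of 1] wrap[of 2] that L(1) by auto
  qed
  have near: "L ! j ! i \<noteq> L ! ((j + 1) mod n) ! i'"
    if "j < n" "i < 4" "i' < 4" "i' \<noteq> (i + 2) mod 4" for i i' j
    using col(4)[OF that(1)] that(2-4) unfolding near_ok_def less_4_cases by blast
  have far: "L ! j ! i \<noteq> L ! ((j + 2) mod n) ! i" if "j < n" "i < 4" for i j
    using col(5)[OF that(1)] that(2) unfolding far_ok_def less_4_cases by blast
  have "L ! j ! i \<noteq> L ! j' ! i'"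
    if "((i, j), (i', j')) \<in> parcs (graph_square (torus_graph 4 n))" for i j i' j'
  proof -
    note D = arc_square_torusD[OF \<open>n \<ge> 3\<close> that]
    \<comment> \<open>Opposition of rows is symmetric, which covers the case where \<open>j\<close>
      is the successor of \<open>j'\<close>.\<close>
    then have "i' \<noteq> (i + 2) mod 4 \<Longrightarrow> i \<noteq> (i' + 2) mod 4" by (auto simp: less_4_cases)
    then show ?thesis
      using D near far col(1,2) by (metis nth_eq_iff_index_eq)
  qed
  moreover have "L ! j ! i < k" if "i < 4" "j < n" for i j
    using col(1,3)[OF that(2)] that(1) by (metis lessThan_iff nth_mem subsetD)
  ultimately show ?thesis
    by (auto simp: proper_coloring_def pverts_graph_square_torus)
qed

text \<open>Each of the six colours occupies two cyclically neighbouring columns, in opposite rows,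
  as the equality case of the count demands.\<close>

definition block3 :: "nat list list" where
  "block3 = [[0,1,2,3],[4,5,0,1],[2,3,4,5]]"

text \<open>The seventh colour 6 allows a length that is 2 modulo 3; \<open>block7\<close> does the
  same for residue 1.\<close>

definition block5 :: "nat list list" where
  "block5 = [[0,1,2,3],[4,5,0,1],[3,2,4,5],[1,0,3,6],[2,6,5,4]]"

definition block7 :: "nat list list" where
  "block7 = [[0,1,2,3],[4,5,0,1],[2,3,4,6],[0,6,1,5],[1,2,0,3],[4,5,6,2],[6,3,4,5]]"

text \<open>The checks look two columns ahead, so those on a prepended \<open>block3\<close> see
  only the common first two columns of what follows. They hold because \<open>block3\<close> closes
  up cyclically.\<close>

lemma proper_coloring_blocks:
  assumes B: "B = [0,1,2,3] # [4,5,0,1] # r" "columns_ok k (B @ [[0,1,2,3],[4,5,0,1]])"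
    and "k \<ge> 6" "n = length B + 3 * a" "n \<ge> 3"
  shows "\<exists>c. proper_coloring (graph_square (torus_graph 4 n)) k c"
proof -
  define L where "L = ((@) block3 ^^ a) B"
  have "\<exists>s. L = [0,1,2,3] # [4,5,0,1] # s"
    unfolding L_def by (cases a) (simp_all add: B(1) block3_def)
  moreover have "length L = n"
    unfolding L_def assms(4) by (induction a) (simp_all add: block3_def)
  \<comment> \<open>The induction needs the second conjunct: it supplies the columns seen from the
    new block.\<close>
  moreover have "columns_ok k (L @ [[0,1,2,3],[4,5,0,1]]) \<and> (\<exists>s. L = [0,1,2,3] # [4,5,0,1] # s)"
    unfolding L_def
  proof (induction a)
    case 0
    then show ?case using B by simp
  next
    case (Suc a)
    then show ?case using \<open>k \<ge> 6\<close> by (auto simp: block3_def near_ok_def far_ok_def)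
  qed
  ultimately show ?thesis using proper_coloring_columns[OF \<open>n \<ge> 3\<close>] by blast
qed

section \<open>The exact values\<close>

lemma chromatic_number_eqI:
  assumes "\<exists>c. proper_coloring G k c" "\<And>k' c. proper_coloring G k' c \<Longrightarrow> k \<le> k'"
  shows "chromatic_number G = k"
  unfolding chromatic_number_def using assms by (blast intro: Least_equality)

theorem theorem6:
  fixes n :: nat
  assumes "n \<ge> 3"
  shows "(n mod 3 = 0 \<longrightarrow> chromatic_number (graph_square (torus_graph 4 n)) = 6) \<and>
         chromatic_number (graph_square (torus_graph 4 4)) = 8 \<and>
         (n mod 3 \<noteq> 0 \<and> n \<noteq> 4 \<longrightarrow> chromatic_number (graph_square (torus_graph 4 n)) = 7)"
proof (intro conjI impI)
  have ge6: "6 \<le> k" if "proper_coloring (graph_square (torus_graph 4 n)) k c" for k c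
    using torus_coloring.colors_ge_6[OF torus_coloring.intro[OF assms that]] .
  show "chromatic_number (graph_square (torus_graph 4 n)) = 6" if "n mod 3 = 0"
  proof (rule chromatic_number_eqI[OF _ ge6])
    have "n = length block3 + 3 * (n div 3 - 1)" using that assms by (auto simp: block3_def)
    then show "\<exists>c. proper_coloring (graph_square (torus_graph 4 n)) 6 c"
      using assms
      by (intro proper_coloring_blocks[of block3 "[[2,3,4,5]]"])
        (auto simp: block3_def near_ok_def far_ok_def)
  qed
  show "chromatic_number (graph_square (torus_graph 4 4)) = 8"
  proof (rule chromatic_number_eqI)
    \<comment> \<open>Two pairs of neighbouring columns use disjoint sets of four colours; within a
      pair the second column is the first shifted by two rows.\<close>
    show "\<exists>c. proper_coloring (graph_square (torus_graph 4 4)) 8 c"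
      by (rule exI, rule proper_coloring_columns[of _ "[[0,1,2,3],[2,3,0,1],[4,5,6,7],[6,7,4,5]]"])
        (auto simp: near_ok_def far_ok_def)
    show "8 \<le> k" if "proper_coloring (graph_square (torus_graph 4 4)) k c" for k c
      using torus_coloring.colors_ge_8[OF torus_coloring.intro[OF _ that]] by simp
  qed
  show "chromatic_number (graph_square (torus_graph 4 n)) = 7" if n: "n mod 3 \<noteq> 0 \<and> n \<noteq> 4"
  proof (rule chromatic_number_eqI)
    show "7 \<le> k" if "proper_coloring (graph_square (torus_graph 4 n)) k c" for k c
      using torus_coloring.six_colors_imp_dvd[OF torus_coloring.intro[OF assms that]] ge6[OF that] n
      by linarith
    consider "n = length block5 + 3 * (n div 3 - 1)" | "n = length block7 + 3 * (n div 3 - 2)"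
    proof -
      \<comment> \<open>Residue 2 forces \<open>n \<ge> 5\<close>. Residue 1 with
        \<open>n \<noteq> 4\<close> forces \<open>n \<ge> 7\<close>, so the relevant subtraction is
        not truncated.\<close>
      have "n = 5 + 3 * (n div 3 - 1) \<or> n = 7 + 3 * (n div 3 - 2)" using n assms by presburger
      then show ?thesis using that by (auto simp: block5_def block7_def)
    qed
    then show "\<exists>c. proper_coloring (graph_square (torus_graph 4 n)) 7 c"
    proof cases
      case 1
      then show ?thesis
        using assms
        by (intro proper_coloring_blocks[of block5 "drop 2 block5"])
          (auto simp: block5_def near_ok_def far_ok_def)
    next
      case 2
      then show ?thesis
        using assms
        by (intro proper_coloring_blocks[of block7 "drop 2 block7"])
          (auto simp: block7_def near_ok_def far_ok_def)
    qed
  qed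
qed

end
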